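(* Let $(X,\tau,\mathscr M,m)$ be a topological measure space. Then $(X,\tau)$ is uniformisable, i.e. there is a uniformity on $X$ whose induced topology is $\tau$.
   Context: Let $(X,\tau)$ be a topological space and $(X,\mathscr M,m)$ a measure space. $(X,\tau,\mathscr M,m)$ is called a topological measure space (tms) if: (i) $\mathscr M$ contains all open sets of $(X,\tau)$; (ii) for every $x\in X$ and every $\varepsilon>0$ there exists an open connected neighbourhood $U$ of $x$ with $m(U)<\varepsilon$; (iii) for every $G\in\tau$ and every $x\in G$ there exists $\varepsilon>0$ such that every open connected neighbourhood $U$ of $x$ with $m(U)<\varepsilon$ satisfies $U\subseteq G$. Uniformities and topological spaces are not assumed to be Hausdorff. *)

theory Defs
  imports "HOL-Analysis.Analysis"
begin

text \<open>
  Uniformities on a carrier set, given by their entourages; no separation axiom is imposed.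
  The type class \<^class>\<open>uniform_space\<close> only covers uniformities on a whole type that are tied to
  a topology by instantiation, so it cannot express existence of a uniformity on a given space.
\<close>

definition is_uniformity :: "'a set \<Rightarrow> ('a \<times> 'a) set set \<Rightarrow> bool" where
  "is_uniformity S \<U> \<longleftrightarrow>
     \<U> \<noteq> {} \<and>
     (\<forall>V\<in>\<U>. Id_on S \<subseteq> V \<and> V \<subseteq> S \<times> S) \<and>
     (\<forall>V\<in>\<U>. \<forall>W. V \<subseteq> W \<and> W \<subseteq> S \<times> S \<longrightarrow> W \<in> \<U>) \<and>
     (\<forall>V\<in>\<U>. \<forall>W\<in>\<U>. V \<inter> W \<in> \<U>) \<and>
     (\<forall>V\<in>\<U>. V\<inverse> \<in> \<U>) \<and>
     (\<forall>V\<in>\<U>. \<exists>W\<in>\<U>. W O W \<subseteq> V)"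

definition uniform_topology :: "'a set \<Rightarrow> ('a \<times> 'a) set set \<Rightarrow> 'a topology" where
  "uniform_topology S \<U> = topology (\<lambda>G. G \<subseteq> S \<and> (\<forall>x\<in>G. \<exists>V\<in>\<U>. V `` {x} \<subseteq> G))"

lemma istopology_uniform:
  assumes "is_uniformity S \<U>"
  shows "istopology (\<lambda>G. G \<subseteq> S \<and> (\<forall>x\<in>G. \<exists>V\<in>\<U>. V `` {x} \<subseteq> G))"
  unfolding istopology_def
proof (intro conjI allI impI ballI)
  fix A B x
  assume A: "A \<subseteq> S \<and> (\<forall>x\<in>A. \<exists>V\<in>\<U>. V `` {x} \<subseteq> A)"
    and B: "B \<subseteq> S \<and> (\<forall>x\<in>B. \<exists>V\<in>\<U>. V `` {x} \<subseteq> B)"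
    and x: "x \<in> A \<inter> B"
  obtain V where V: "V \<in> \<U>" "V `` {x} \<subseteq> A"
    using bspec[OF conjunct2[OF A] IntD1[OF x]] by (rule bexE)
  obtain W where W: "W \<in> \<U>" "W `` {x} \<subseteq> B"
    using bspec[OF conjunct2[OF B] IntD2[OF x]] by (rule bexE)
  have "\<forall>V\<in>\<U>. \<forall>W\<in>\<U>. V \<inter> W \<in> \<U>"
    using assms unfolding is_uniformity_def by (elim conjE)
  from bspec[OF bspec[OF this V(1)] W(1)] have "V \<inter> W \<in> \<U>" .
  moreover have "(V \<inter> W) `` {x} \<subseteq> A \<inter> B" using V(2) W(2) by fast
  ultimately show "\<exists>V\<in>\<U>. V `` {x} \<subseteq> A \<inter> B" by (rule rev_bexI)
next
  fix \<K> x
  assume K: "\<forall>G\<in>\<K>. G \<subseteq> S \<and> (\<forall>x\<in>G. \<exists>V\<in>\<U>. V `` {x} \<subseteq> G)" and "x \<in> \<Union>\<K>"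
  then obtain G where G: "x \<in> G" "G \<in> \<K>" by (elim UnionE)
  obtain V where V: "V \<in> \<U>" "V `` {x} \<subseteq> G"
    using bspec[OF conjunct2[OF bspec[OF K G(2)]] G(1)] by (rule bexE)
  show "\<exists>V\<in>\<U>. V `` {x} \<subseteq> \<Union>\<K>"
    using V(1) order_trans[OF V(2) Union_upper[OF G(2)]] by (rule rev_bexI)
qed fast+

lemma openin_uniform_topology:
  assumes "is_uniformity S \<U>"
  shows "openin (uniform_topology S \<U>) G \<longleftrightarrow> G \<subseteq> S \<and> (\<forall>x\<in>G. \<exists>V\<in>\<U>. V `` {x} \<subseteq> G)"
  by (simp only: uniform_topology_def topology_inverse'[OF istopology_uniform[OF assms]])

lemma topspace_uniform_topology:
  assumes "is_uniformity S \<U>"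
  shows "topspace (uniform_topology S \<U>) = S"
proof (rule subset_antisym)
  show "topspace (uniform_topology S \<U>) \<subseteq> S"
    using openin_topspace[of "uniform_topology S \<U>"]
    unfolding openin_uniform_topology[OF assms] by (rule conjunct1)
next
  have "\<U> \<noteq> {}"
    using assms unfolding is_uniformity_def by (elim conjE)
  then obtain V where V: "V \<in> \<U>" by (meson ex_in_conv)
  have "\<forall>V\<in>\<U>. Id_on S \<subseteq> V \<and> V \<subseteq> S \<times> S"
    using assms unfolding is_uniformity_def by (elim conjE)
  from conjunct2[OF bspec[OF this V]] have "V `` {x} \<subseteq> S" for x
    by (auto dest: subsetD)
  with V have "\<exists>V\<in>\<U>. V `` {x} \<subseteq> S" for x
    by (rule_tac rev_bexI)
  then have "openin (uniform_topology S \<U>) S"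
    unfolding openin_uniform_topology[OF assms] by (intro conjI ballI order_refl)
  then show "S \<subseteq> topspace (uniform_topology S \<U>)"
    by (rule openin_subset)
qed

definition uniformisable_space :: "'a topology \<Rightarrow> bool" where
  "uniformisable_space X \<longleftrightarrow>
     (\<exists>\<U>. is_uniformity (topspace X) \<U> \<and> uniform_topology (topspace X) \<U> = X)"

definition topological_measure_space :: "'a topology \<Rightarrow> 'a measure \<Rightarrow> bool" where
  "topological_measure_space X M \<longleftrightarrow>
     space M = topspace X \<and>
     (\<forall>U. openin X U \<longrightarrow> U \<in> sets M) \<and>
     (\<forall>x\<in>topspace X. \<forall>\<epsilon>::real>0.
        \<exists>U. openin X U \<and> connectedin X U \<and> x \<in> U \<and> emeasure M U < ennreal \<epsilon>) \<and>
     (\<forall>G. openin X G \<longrightarrow> (\<forall>x\<in>G. \<exists>\<epsilon>::real>0.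
        \<forall>U. openin X U \<and> connectedin X U \<and> x \<in> U \<and> emeasure M U < ennreal \<epsilon> \<longrightarrow> U \<subseteq> G))"

end

theory Submission
  imports Defs
begin

text \<open>
  Call two points \<open>\<epsilon>\<close>-close if a single open connected set of measure below \<open>\<epsilon>\<close> contains both.
  Closeness is symmetric by its form and reflexive because every point has open connected
  neighbourhoods of arbitrarily small measure. It also satisfies a triangle inequality: if \<open>U\<close>
  joins \<open>x\<close> to \<open>y\<close> and \<open>V\<close> joins \<open>y\<close> to \<open>z\<close>, then \<open>U \<union> V\<close> is open, it is connected since both
  parts contain \<open>y\<close>, and its measure is at most the sum of the two measures
  (\<open>close_pairs_triangle\<close>). In other words, the infimum of the measures of the open connected sets
  containing \<open>x\<close> and \<open>y\<close> is a pseudometric, possibly with infinite values, and the relations of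
  \<open>\<epsilon>\<close>-closeness form a base of the uniformity that it defines.

  The ball of radius \<open>\<epsilon>\<close> about \<open>x\<close> is the union of all open connected neighbourhoods of \<open>x\<close> of
  measure below \<open>\<epsilon>\<close>, so it is open. The third axiom of a topological measure space says that such
  balls lie in any given neighbourhood of \<open>x\<close> once \<open>\<epsilon>\<close> is small. Hence the induced topology is the
  given one.
\<close>

definition close_pairs :: "'a topology \<Rightarrow> 'a measure \<Rightarrow> real \<Rightarrow> ('a \<times> 'a) set" where
  "close_pairs X M \<epsilon> =
     {(x, y). \<exists>U. openin X U \<and> connectedin X U \<and> x \<in> U \<and> y \<in> U \<and> emeasure M U < ennreal \<epsilon>}"

definition measure_uniformity :: "'a topology \<Rightarrow> 'a measure \<Rightarrow> ('a \<times> 'a) set set" where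
  "measure_uniformity X M =
     {W. W \<subseteq> topspace X \<times> topspace X \<and> (\<exists>\<epsilon>>0. close_pairs X M \<epsilon> \<subseteq> W)}"

lemma close_pairs_subset: "close_pairs X M \<epsilon> \<subseteq> topspace X \<times> topspace X"
  unfolding close_pairs_def by (auto dest: openin_subset)

lemma close_pairs_mono: "\<delta> \<le> \<epsilon> \<Longrightarrow> close_pairs X M \<delta> \<subseteq> close_pairs X M \<epsilon>"
  unfolding close_pairs_def by (auto intro: less_le_trans ennreal_leI)

lemma converse_close_pairs: "(close_pairs X M \<epsilon>)\<inverse> = close_pairs X M \<epsilon>"
  unfolding close_pairs_def by auto

lemma close_pairs_refl:
  assumes "topological_measure_space X M" "0 < \<epsilon>"
  shows "Id_on (topspace X) \<subseteq> close_pairs X M \<epsilon>"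
proof
  fix p assume "p \<in> Id_on (topspace X)"
  then obtain x where p: "p = (x, x)" and "x \<in> topspace X"
    by blast
  then obtain U where "openin X U" "connectedin X U" "x \<in> U" "emeasure M U < ennreal \<epsilon>"
    using assms unfolding topological_measure_space_def by meson
  then show "p \<in> close_pairs X M \<epsilon>"
    unfolding p close_pairs_def by blast
qed

text \<open>
  The union of two witnesses is again a witness: the common point \<open>y\<close> keeps it connected, and
  subadditivity, available since open sets are measurable, bounds its measure.
\<close>

lemma close_pairs_triangle:
  assumes sets: "\<And>U. openin X U \<Longrightarrow> U \<in> sets M"
    and pos: "0 < \<delta>" "0 < \<epsilon>"
  shows "close_pairs X M \<delta> O close_pairs X M \<epsilon> \<subseteq> close_pairs X M (\<delta> + \<epsilon>)"
proof
  fix p assume "p \<in> close_pairs X M \<delta> O close_pairs X M \<epsilon>"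
  then obtain x y z U V where p: "p = (x, z)"
    and U: "openin X U" "connectedin X U" "x \<in> U" "y \<in> U" "emeasure M U < ennreal \<delta>"
    and V: "openin X V" "connectedin X V" "y \<in> V" "z \<in> V" "emeasure M V < ennreal \<epsilon>"
    unfolding close_pairs_def by blast
  have "connectedin X (U \<union> V)"
    using U V by (blast intro: connectedin_Un)
  moreover have "emeasure M (U \<union> V) < ennreal (\<delta> + \<epsilon>)"
  proof -
    have "emeasure M (U \<union> V) \<le> emeasure M U + emeasure M V"
      using U(1) V(1) by (intro emeasure_subadditive sets)
    also have "\<dots> < ennreal \<delta> + ennreal \<epsilon>"
      using U(5) V(5) by (rule add_strict_mono)
    finally show ?thesis
      using pos by (simp add: ennreal_plus)
  qed
  ultimately show "p \<in> close_pairs X M (\<delta> + \<epsilon>)"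
    using U V openin_Un[of X U V] unfolding p close_pairs_def by blast
qed

text \<open>
  A witness for \<open>x\<close> and \<open>y\<close> also witnesses that \<open>x\<close> is close to every other point of it, so
  a ball is a union of open sets.
\<close>

lemma openin_close_pairs_Image: "openin X (close_pairs X M \<epsilon> `` {x})"
proof -
  have "close_pairs X M \<epsilon> `` {x} =
      \<Union>{U. openin X U \<and> connectedin X U \<and> x \<in> U \<and> emeasure M U < ennreal \<epsilon>}"
    unfolding close_pairs_def by auto
  then show ?thesis
    by (auto intro: openin_Union)
qed

lemma measure_uniformityI:
  "0 < \<epsilon> \<Longrightarrow> close_pairs X M \<epsilon> \<in> measure_uniformity X M"
  unfolding measure_uniformity_def using close_pairs_subset by blast

lemma is_uniformity_measure_uniformity:
  assumes tms: "topological_measure_space X M"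
  shows "is_uniformity (topspace X) (measure_uniformity X M)"
  unfolding is_uniformity_def
proof (intro conjI ballI allI impI)
  show "measure_uniformity X M \<noteq> {}"
    using measure_uniformityI[OF zero_less_one] by blast
next
  fix V assume "V \<in> measure_uniformity X M"
  then show "Id_on (topspace X) \<subseteq> V"
    using close_pairs_refl[OF tms] unfolding measure_uniformity_def by blast
next
  fix V assume "V \<in> measure_uniformity X M"
  then show "V \<subseteq> topspace X \<times> topspace X"
    unfolding measure_uniformity_def by blast
next
  fix V W
  assume "V \<in> measure_uniformity X M" "V \<subseteq> W \<and> W \<subseteq> topspace X \<times> topspace X"
  then show "W \<in> measure_uniformity X M"
    unfolding measure_uniformity_def by blast
next
  fix V W
  assume V: "V \<in> measure_uniformity X M" and W: "W \<in> measure_uniformity X M"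
  then obtain \<delta> \<epsilon> where "0 < \<delta>" "close_pairs X M \<delta> \<subseteq> V" "0 < \<epsilon>" "close_pairs X M \<epsilon> \<subseteq> W"
    unfolding measure_uniformity_def by blast
  moreover have "close_pairs X M (min \<delta> \<epsilon>) \<subseteq> close_pairs X M \<delta>"
      "close_pairs X M (min \<delta> \<epsilon>) \<subseteq> close_pairs X M \<epsilon>"
    by (intro close_pairs_mono; simp)+
  ultimately have "0 < min \<delta> \<epsilon>" "close_pairs X M (min \<delta> \<epsilon>) \<subseteq> V \<inter> W"
    by auto
  then show "V \<inter> W \<in> measure_uniformity X M"
    using V unfolding measure_uniformity_def by blast
next
  fix V assume "V \<in> measure_uniformity X M"
  then obtain \<epsilon> where "V \<subseteq> topspace X \<times> topspace X" "0 < \<epsilon>" "close_pairs X M \<epsilon> \<subseteq> V"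
    unfolding measure_uniformity_def by blast
  moreover from this have "close_pairs X M \<epsilon> \<subseteq> V\<inverse>"
    using converse_close_pairs[of X M \<epsilon>] by blast
  ultimately show "V\<inverse> \<in> measure_uniformity X M"
    unfolding measure_uniformity_def by blast
next
  fix V assume "V \<in> measure_uniformity X M"
  then obtain \<epsilon> where \<epsilon>: "0 < \<epsilon>" "close_pairs X M \<epsilon> \<subseteq> V"
    unfolding measure_uniformity_def by blast
  \<comment> \<open>Two steps of half the radius compose to one step of the full radius.\<close>
  have "close_pairs X M (\<epsilon>/2) O close_pairs X M (\<epsilon>/2) \<subseteq> close_pairs X M (\<epsilon>/2 + \<epsilon>/2)"
    using tms \<epsilon>(1) unfolding topological_measure_space_def by (intro close_pairs_triangle) auto
  then have "close_pairs X M (\<epsilon>/2) O close_pairs X M (\<epsilon>/2) \<subseteq> V"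
    using \<epsilon>(2) by simp
  then show "\<exists>W\<in>measure_uniformity X M. W O W \<subseteq> V"
    using measure_uniformityI[of "\<epsilon>/2" X M] \<epsilon>(1) by (intro bexI) auto
qed

text \<open>
  Left to right is the axiom that small open connected neighbourhoods of a point lie in any given
  neighbourhood of it. Right to left holds because the balls are themselves open.
\<close>

lemma openin_iff_measure_uniformity:
  assumes tms: "topological_measure_space X M"
  shows "openin X G \<longleftrightarrow>
    G \<subseteq> topspace X \<and> (\<forall>x\<in>G. \<exists>V\<in>measure_uniformity X M. V `` {x} \<subseteq> G)"
proof
  assume G: "openin X G"
  show "G \<subseteq> topspace X \<and> (\<forall>x\<in>G. \<exists>V\<in>measure_uniformity X M. V `` {x} \<subseteq> G)"
  proof (intro conjI ballI)
    show "G \<subseteq> topspace X"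
      using G by (rule openin_subset)
    fix x assume "x \<in> G"
    then obtain \<epsilon> :: real where "0 < \<epsilon>"
      and *: "\<And>U. openin X U \<Longrightarrow> connectedin X U \<Longrightarrow> x \<in> U \<Longrightarrow> emeasure M U < ennreal \<epsilon> \<Longrightarrow> U \<subseteq> G"
      using tms G unfolding topological_measure_space_def by meson
    have "close_pairs X M \<epsilon> `` {x} \<subseteq> G"
      unfolding close_pairs_def using * by blast
    then show "\<exists>V\<in>measure_uniformity X M. V `` {x} \<subseteq> G"
      using measure_uniformityI[OF \<open>0 < \<epsilon>\<close>] by blast
  qed
next
  assume G: "G \<subseteq> topspace X \<and> (\<forall>x\<in>G. \<exists>V\<in>measure_uniformity X M. V `` {x} \<subseteq> G)"
  show "openin X G"
  proof (subst openin_subopen, intro ballI)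
    fix x assume x: "x \<in> G"
    then obtain \<epsilon> where "0 < \<epsilon>" "close_pairs X M \<epsilon> `` {x} \<subseteq> G"
      using G unfolding measure_uniformity_def by blast
    moreover have "x \<in> close_pairs X M \<epsilon> `` {x}"
      using close_pairs_refl[OF tms \<open>0 < \<epsilon>\<close>] x G by blast
    ultimately show "\<exists>T. openin X T \<and> x \<in> T \<and> T \<subseteq> G"
      by (intro exI[of _ "close_pairs X M \<epsilon> `` {x}"] conjI openin_close_pairs_Image)
  qed
qed

theorem theorem2p11:
  fixes X :: "'a topology" and M :: "'a measure"
  assumes "topological_measure_space X M"
  shows "uniformisable_space X"
proof -
  have "uniform_topology (topspace X) (measure_uniformity X M) = X"
    unfolding topology_eq openin_uniform_topology[OF is_uniformity_measure_uniformity[OF assms]]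
    using openin_iff_measure_uniformity[OF assms] by blast
  then show ?thesis
    using is_uniformity_measure_uniformity[OF assms] unfolding uniformisable_space_def by blast
qed

end
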